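(* Let $p$ be an odd prime. Then there exists a regular quaternary Hadamard matrix of order $p^2+1$ with row sum $p+i$.
   Context: A quaternary Hadamard matrix of order $n$ is an $n\times n$ matrix $H$ with entries in $\{1,-1,i,-i\}$ such that $HH^*=nI_n$, where $H^*$ is the conjugate transpose. It is regular if all its row sums are equal to the same complex number (called its row sum). *)

theory Defs
  imports
    Jordan_Normal_Form.Schur_Decomposition
    "HOL-Computational_Algebra.Primes"
begin

definition quaternary_hadamard :: "nat \<Rightarrow> complex mat \<Rightarrow> bool" where
  "quaternary_hadamard n H \<longleftrightarrow>
     H \<in> carrier_mat n n \<and>
     elements_mat H \<subseteq> {1, -1, \<i>, -\<i>} \<and>
     H * mat_adjoint H = of_nat n \<cdot>\<^sub>m 1\<^sub>m n"

(* If A has at least one row, then s is uniquely determined by A and is its row sum;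
   A is regular iff such an s exists. *)
definition regular_with_row_sum :: "'a :: comm_monoid_add mat \<Rightarrow> 'a \<Rightarrow> bool" where
  "regular_with_row_sum A s \<longleftrightarrow> (\<forall>i < dim_row A. (\<Sum>j < dim_col A. A $$ (i, j)) = s)"

end

theory Submission
  imports Defs
begin

text \<open>
  Assign signs of total sum zero to the \<open>p + 1\<close> parallel classes of the affine plane of order
  \<open>p\<close>, and let \<open>S\<close> be the signed sum of the collinearity matrices \<open>N\<^sub>c\<close> of the classes. Since
  \<open>N\<^sub>c N\<^sub>c = p N\<^sub>c\<close> and \<open>N\<^sub>c N\<^sub>d = J\<close> for \<open>c \<noteq> d\<close>, we get \<open>S\<^sup>2 = p\<^sup>2 I - J\<close>, so bordering \<open>S\<close> with
  ones gives a symmetric conference matrix \<open>C\<close> of order \<open>p\<^sup>2 + 1\<close>. A vector with entries \<open>1\<close> and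
  \<open>-1\<close> that is constant on the lines of a class of sign \<open>1\<close>, has sum \<open>p\<close>, and is extended by
  \<open>1\<close>, is an eigenvector of \<open>C\<close> for the eigenvalue \<open>p\<close>. Conjugating \<open>C\<close> with the corresponding
  diagonal matrix \<open>D\<close> makes all row sums equal to \<open>p\<close>, and \<open>D C D + \<i> I\<close> is the required matrix.
\<close>

section \<open>From conference matrices to quaternary Hadamard matrices\<close>

text \<open>Permuting rows and columns by the same bijection preserves all the conditions, so any
  enumeration of \<open>V\<close> serves. This permits index sets other than initial segments of the
  naturals.\<close>

lemma quaternary_hadamard_of_function:
  fixes h :: "'a \<Rightarrow> 'a \<Rightarrow> complex"
  assumes fin: "finite V"
    and entries: "\<And>x y. x \<in> V \<Longrightarrow> y \<in> V \<Longrightarrow> h x y \<in> {1, -1, \<i>, -\<i>}"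
    and orth: "\<And>x y. x \<in> V \<Longrightarrow> y \<in> V \<Longrightarrow>
      (\<Sum>z\<in>V. h x z * cnj (h y z)) = (if x = y then of_nat (card V) else 0)"
    and row: "\<And>x. x \<in> V \<Longrightarrow> (\<Sum>z\<in>V. h x z) = s"
  shows "\<exists>H. quaternary_hadamard (card V) H \<and> regular_with_row_sum H s"
proof -
  let ?n = "card V"
  obtain b where b: "bij_betw b {0..<?n} V"
    using ex_bij_betw_nat_finite[OF fin] by blast
  have bV: "b i \<in> V" if "i < ?n" for i
    using b that by (auto simp: bij_betw_def)
  have b_eq: "b i = b j \<longleftrightarrow> i = j" if "i < ?n" "j < ?n" for i j
    using b that by (auto simp: bij_betw_def inj_on_def)
  define H where "H = mat ?n ?n (\<lambda>(i, j). h (b i) (b j))"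
  have H: "H \<in> carrier_mat ?n ?n"
    by (simp add: H_def)
  have sum_b: "(\<Sum>k = 0..<?n. f (b k)) = (\<Sum>z\<in>V. f z)" for f :: "'a \<Rightarrow> complex"
    by (rule sum.reindex_bij_betw[OF b])
  have "elements_mat H \<subseteq> {1, -1, \<i>, -\<i>}"
  proof
    fix a assume "a \<in> elements_mat H"
    then obtain i j where "i < ?n" "j < ?n" "a = h (b i) (b j)"
      by (auto simp: H_def dest!: elements_matD)
    then show "a \<in> {1, -1, \<i>, -\<i>}"
      using entries bV by blast
  qed
  moreover have "H * mat_adjoint H = of_nat ?n \<cdot>\<^sub>m 1\<^sub>m ?n"
  proof (rule eq_matI)
    fix i j assume "i < dim_row (of_nat ?n \<cdot>\<^sub>m 1\<^sub>m ?n :: complex mat)"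
      "j < dim_col (of_nat ?n \<cdot>\<^sub>m 1\<^sub>m ?n :: complex mat)"
    then have ij: "i < ?n" "j < ?n" by auto
    have "(H * mat_adjoint H) $$ (i, j) = (\<Sum>k = 0..<?n. h (b i) (b k) * cnj (h (b j) (b k)))"
      using ij by (simp add: H_def mat_adjoint_def scalar_prod_def mat_of_rows_def)
    also have "\<dots> = (\<Sum>z\<in>V. h (b i) z * cnj (h (b j) z))"
      by (rule sum_b)
    also have "\<dots> = (of_nat ?n \<cdot>\<^sub>m 1\<^sub>m ?n) $$ (i, j)"
      using ij bV b_eq by (simp add: orth)
    finally show "(H * mat_adjoint H) $$ (i, j) = (of_nat ?n \<cdot>\<^sub>m 1\<^sub>m ?n) $$ (i, j)" .
  qed (auto simp: H_def mat_adjoint_def)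
  moreover have "regular_with_row_sum H s"
    by (simp add: regular_with_row_sum_def H_def lessThan_atLeast0 sum_b[of "h _"] row bV)
  ultimately show ?thesis
    using H unfolding quaternary_hadamard_def by blast
qed

text \<open>For \<open>M = D C D\<close>, with \<open>D\<close> the diagonal matrix of
  \<open>d\<close>, \<open>M\<close> is real symmetric and squares to \<open>(card V - 1) I\<close>.
  Hence \<open>(M + \<i> I) (M - \<i> I) = M M + I = card V I\<close>. The eigenvector equation
  turns into constant row sums \<open>s\<close> of \<open>M\<close> because
  \<open>d x * d x = 1\<close>.\<close>

lemma quaternary_hadamard_of_conference:
  fixes C :: "'a \<Rightarrow> 'a \<Rightarrow> int" and d :: "'a \<Rightarrow> int" and s :: int
  assumes fin: "finite V"
    and diag: "\<And>x. x \<in> V \<Longrightarrow> C x x = 0"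
    and off_diag: "\<And>x y. x \<in> V \<Longrightarrow> y \<in> V \<Longrightarrow> x \<noteq> y \<Longrightarrow> C x y \<in> {1, -1}"
    and sym: "\<And>x y. x \<in> V \<Longrightarrow> y \<in> V \<Longrightarrow> C x y = C y x"
    and square: "\<And>x y. x \<in> V \<Longrightarrow> y \<in> V \<Longrightarrow>
      (\<Sum>z\<in>V. C x z * C z y) = (if x = y then int (card V) - 1 else 0)"
    and sign: "\<And>x. x \<in> V \<Longrightarrow> d x \<in> {1, -1}"
    and eigen: "\<And>x. x \<in> V \<Longrightarrow> (\<Sum>z\<in>V. C x z * d z) = s * d x"
  shows "\<exists>H. quaternary_hadamard (card V) H \<and> regular_with_row_sum H (of_int s + \<i>)"
proof -
  define h where "h x y = of_int (d x * C x y * d y) + (if x = y then \<i> else 0)" for x y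
  have dd: "d x * d x = 1" if "x \<in> V" for x
    using sign[OF that] by auto
  show ?thesis
  proof (rule quaternary_hadamard_of_function[OF fin, where h = h])
    fix x assume x: "x \<in> V"
    have "(\<Sum>z\<in>V. d x * C x z * d z) = d x * (\<Sum>z\<in>V. C x z * d z)"
      by (simp add: sum_distrib_left mult.assoc)
    also have "\<dots> = s * (d x * d x)"
      by (subst eigen[OF x]) (simp add: mult_ac)
    finally have "(\<Sum>z\<in>V. d x * C x z * d z) = s"
      using dd[OF x] by simp
    then have "(\<Sum>z\<in>V. of_int (d x * C x z * d z)) = (of_int s :: complex)"
      unfolding of_int_sum[symmetric] by (rule arg_cong)
    then show "(\<Sum>z\<in>V. h x z) = of_int s + \<i>"
      unfolding h_def sum.distrib using x fin by (simp add: sum.delta)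
    fix y assume y: "y \<in> V"
    show "h x y \<in> {1, -1, \<i>, -\<i>}"
      using diag[OF x] off_diag[OF x y] sign[OF x] sign[OF y] by (auto simp: h_def)
    have "(\<Sum>z\<in>V. (d x * C x z * d z) * (d y * C y z * d z))
        = (\<Sum>z\<in>V. (d x * d y) * (C x z * C z y))"
    proof (rule sum.cong[OF refl])
      fix z assume z: "z \<in> V"
      have "(d x * C x z * d z) * (d y * C y z * d z)
          = (d x * d y) * (C x z * C y z) * (d z * d z)"
        by (simp add: mult_ac)
      then show "(d x * C x z * d z) * (d y * C y z * d z) = (d x * d y) * (C x z * C z y)"
        using dd[OF z] sym[OF y z] by simp
    qed
    also have "\<dots> = (if x = y then int (card V) - 1 else 0)"
      using dd[OF x] dd[OF y] by (simp add: sum_distrib_left[symmetric] square[OF x y])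
    finally have real_part: "(\<Sum>z\<in>V. of_int ((d x * C x z * d z) * (d y * C y z * d z)))
        = (if x = y then of_nat (card V) - 1 else 0 :: complex)"
      unfolding of_int_sum[symmetric] by simp
    \<comment> \<open>The last term is \<open>\<i> * cnj \<i> = 1\<close>; it supplies the 1 missing
      on the diagonal. The two mixed terms cancel later by symmetry. Keeping the conditionals
      separate lets each sum over \<open>z\<close> collapse on its own.\<close>
    have expand: "(of_int a + (if Q then \<i> else 0)) * cnj (of_int b + (if R then \<i> else 0))
        = of_int (a * b) + (if Q then \<i> * of_int b else 0) - (if R then \<i> * of_int a else 0)
          + (if Q then if R then 1 else 0 else 0)" for a b :: int and Q R
      by (simp add: algebra_simps)
    have "h x z * cnj (h y z) = of_int ((d x * C x z * d z) * (d y * C y z * d z))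
        + (if x = z then \<i> * of_int (d y * C y x * d x) else 0)
        - (if y = z then \<i> * of_int (d x * C x y * d y) else 0)
        + (if x = z then if x = y then 1 else 0 else 0)" for z
      unfolding h_def expand by (cases "x = z"; cases "y = z") auto
    then have "(\<Sum>z\<in>V. h x z * cnj (h y z)) = (if x = y then of_nat (card V) - 1 else 0)
        + \<i> * of_int (d y * C y x * d x) - \<i> * of_int (d x * C x y * d y)
        + (if x = y then 1 else 0)"
      using x y fin real_part by (simp only: sum.distrib sum_subtractf sum.delta' sum.delta if_True)
    then show "(\<Sum>z\<in>V. h x z * cnj (h y z)) = (if x = y then of_nat (card V) else 0)"
      using sym[OF x y] by (simp add: mult_ac)
  qed
qed

section \<open>Affine planes: counting points on lines\<close>

text \<open>An affine plane of order \<open>card L\<close>: the line of class \<open>c\<close> through the point \<open>x\<close> is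
  represented by its label \<open>l c x\<close>.\<close>

locale affine_plane =
  fixes I :: "'c set" and P :: "'a set" and L :: "'b set" and l :: "'c \<Rightarrow> 'a \<Rightarrow> 'b"
  assumes finite_lines: "finite L"
    and lines_nonempty: "L \<noteq> {}"
    and finite_classes: "finite I"
    and card_classes: "card I = card L + 1"
    and coordinates: "\<And>c d. c \<in> I \<Longrightarrow> d \<in> I \<Longrightarrow> c \<noteq> d \<Longrightarrow>
      bij_betw (\<lambda>z. (l c z, l d z)) P (L \<times> L)"
    and joined: "\<And>x y. x \<in> P \<Longrightarrow> y \<in> P \<Longrightarrow> x \<noteq> y \<Longrightarrow> \<exists>c\<in>I. l c x = l c y"
begin

lemma obtain_other_class:
  obtains d where "d \<in> I" "d \<noteq> c"
proof -
  have "0 < card L"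
    using finite_lines lines_nonempty by (simp add: card_gt_0_iff)
  then have "\<not> I \<subseteq> {c}"
    using card_classes card_mono[of "{c}" I] by auto
  then show ?thesis
    using that by blast
qed

lemma two_classes:
  obtains c d where "c \<in> I" "d \<in> I" "c \<noteq> d"
proof -
  obtain c where "c \<in> I" by (rule obtain_other_class)
  moreover obtain d where "d \<in> I" "d \<noteq> c" by (rule obtain_other_class)
  ultimately show ?thesis
    using that by blast
qed

lemma finite_points: "finite P"
proof -
  obtain c d where "c \<in> I" "d \<in> I" "c \<noteq> d" by (rule two_classes)
  from bij_betw_finite[OF coordinates[OF this]] show ?thesis
    using finite_lines by simp
qed

lemma card_points: "card P = (card L)\<^sup>2"
proof -
  obtain c d where "c \<in> I" "d \<in> I" "c \<noteq> d" by (rule two_classes)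
  from bij_betw_same_card[OF coordinates[OF this]] show ?thesis
    by (simp add: card_cartesian_product power2_eq_square)
qed

lemma label_in: "c \<in> I \<Longrightarrow> x \<in> P \<Longrightarrow> l c x \<in> L"
proof -
  assume c: "c \<in> I" and x: "x \<in> P"
  obtain d where "d \<in> I" "d \<noteq> c" by (rule obtain_other_class)
  then have "(l c x, l d x) \<in> L \<times> L"
    using bij_betwE[OF coordinates[OF c, of d]] x by blast
  then show "l c x \<in> L"
    by simp
qed

text \<open>The line of class \<open>c\<close> through \<open>x\<close> has \<open>card L\<close>
  points, on which \<open>g (l c z)\<close> is constant, and it meets each line of any other class
  exactly once.\<close>

lemma line_sum:
  fixes g :: "'b \<Rightarrow> int"
  assumes c: "c \<in> I" and d: "d \<in> I" and x: "x \<in> P"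
  shows "(\<Sum>z\<in>P. of_bool (l c x = l c z) * g (l d z))
    = (if c = d then int (card L) * g (l c x) else (\<Sum>t\<in>L. g t))"
proof -
  have reindex: "(\<Sum>z\<in>P. F (l c z) (l e z)) = (\<Sum>s\<in>L. \<Sum>t\<in>L. F s t)"
    if "e \<in> I" "c \<noteq> e" for e and F :: "'b \<Rightarrow> 'b \<Rightarrow> int"
    using sum.reindex_bij_betw[OF coordinates[OF c that], of "\<lambda>(s, t). F s t"]
    by (simp add: sum.cartesian_product)
  have delta: "(\<Sum>s\<in>L. of_bool (l c x = s) * k s) = k (l c x)" for k :: "'b \<Rightarrow> int"
    using label_in[OF c x] finite_lines by simp
  show ?thesis
  proof (cases "c = d")
    case True
    \<comment> \<open>The class \<open>e\<close> serves only as a second coordinate, enumerating the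
      points of each line of class \<open>c\<close>.\<close>
    obtain e where e: "e \<in> I" "e \<noteq> c" by (rule obtain_other_class)
    have "(\<Sum>z\<in>P. of_bool (l c x = l c z) * g (l d z))
        = (\<Sum>s\<in>L. \<Sum>t\<in>L. of_bool (l c x = s) * g s)"
      unfolding True[symmetric] by (rule reindex[OF e(1) e(2)[symmetric]])
    also have "\<dots> = (\<Sum>s\<in>L. of_bool (l c x = s) * (int (card L) * g s))"
      by (simp only: sum_constant mult.left_commute)
    finally show ?thesis
      by (simp only: delta True[symmetric] refl if_True)
  next
    case False
    have "(\<Sum>z\<in>P. of_bool (l c x = l c z) * g (l d z))
        = (\<Sum>s\<in>L. \<Sum>t\<in>L. of_bool (l c x = s) * g t)"
      by (rule reindex[OF d False])
    also have "\<dots> = (\<Sum>s\<in>L. of_bool (l c x = s) * (\<Sum>t\<in>L. g t))"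
      by (simp only: sum_distrib_left)
    finally show ?thesis
      using False by (simp only: delta if_False)
  qed
qed

lemma common_class_unique:
  assumes "x \<in> P" "y \<in> P" "x \<noteq> y" "c \<in> I" "d \<in> I" "l c x = l c y" "l d x = l d y"
  shows "c = d"
proof (rule ccontr)
  assume "c \<noteq> d"
  then have "inj_on (\<lambda>z. (l c z, l d z)) P"
    using assms(4,5) by (intro bij_betw_imp_inj_on[OF coordinates])
  from inj_onD[OF this _ assms(1,2)] show False
    using assms(3,6,7) by simp
qed

lemma obtain_common_class:
  assumes "x \<in> P" "y \<in> P" "x \<noteq> y"
  obtains c where "c \<in> I" "\<And>d. d \<in> I \<Longrightarrow> l d x = l d y \<longleftrightarrow> d = c"
proof -
  obtain c where "c \<in> I" "l c x = l c y"
    using joined[OF assms] by blast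
  then show ?thesis
    using that common_class_unique[OF assms] by blast
qed

section \<open>Signed collinearity matrices\<close>

text \<open>On the diagonal all signs are added up; for two distinct points only the class of the
  line joining them contributes.\<close>

definition signed_collinearity :: "('c \<Rightarrow> int) \<Rightarrow> 'a \<Rightarrow> 'a \<Rightarrow> int" where
  "signed_collinearity \<epsilon> x y = (\<Sum>c\<in>I. \<epsilon> c * of_bool (l c x = l c y))"

lemma signed_collinearity_sym: "signed_collinearity \<epsilon> x y = signed_collinearity \<epsilon> y x"
  unfolding signed_collinearity_def by (rule sum.cong) auto

lemma signed_collinearity_off_diag:
  assumes "x \<in> P" "y \<in> P" "x \<noteq> y"
  shows "signed_collinearity \<epsilon> x y \<in> \<epsilon> ` I"
proof -
  obtain c where c: "c \<in> I" "\<And>d. d \<in> I \<Longrightarrow> l d x = l d y \<longleftrightarrow> d = c"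
    using obtain_common_class[OF assms] by blast
  have "signed_collinearity \<epsilon> x y = (\<Sum>d\<in>I. if d = c then \<epsilon> d else 0)"
    unfolding signed_collinearity_def by (rule sum.cong) (auto simp: c(2))
  then show ?thesis
    using c(1) finite_classes by simp
qed

text \<open>The classes other than \<open>d\<close> each contribute their sign times the sum of
  \<open>g\<close>. Since all signs cancel, these contributions total \<open>- \<epsilon> d\<close>
  times that sum. Constant \<open>g\<close> gives the row sums, the indicator of a line gives the
  square, and a sign function gives the eigenvector.\<close>

lemma signed_collinearity_apply:
  assumes "x \<in> P" "d \<in> I" and sum0: "(\<Sum>c\<in>I. \<epsilon> c) = 0"
  shows "(\<Sum>z\<in>P. signed_collinearity \<epsilon> x z * g (l d z))
    = \<epsilon> d * (int (card L) * g (l d x) - (\<Sum>t\<in>L. g t))"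
proof -
  let ?G = "\<Sum>t\<in>L. g t"
  have "(\<Sum>z\<in>P. signed_collinearity \<epsilon> x z * g (l d z))
      = (\<Sum>c\<in>I. \<epsilon> c * (\<Sum>z\<in>P. of_bool (l c x = l c z) * g (l d z)))"
    unfolding signed_collinearity_def sum_distrib_right sum_distrib_left
    by (subst sum.swap) (simp add: mult.assoc)
  also have "\<dots> = (\<Sum>c\<in>I. \<epsilon> c * ?G
      + (if c = d then \<epsilon> d * (int (card L) * g (l d x) - ?G) else 0))"
  proof (rule sum.cong[OF refl])
    fix c assume c: "c \<in> I"
    show "\<epsilon> c * (\<Sum>z\<in>P. of_bool (l c x = l c z) * g (l d z))
        = \<epsilon> c * ?G + (if c = d then \<epsilon> d * (int (card L) * g (l d x) - ?G) else 0)"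
      unfolding line_sum[OF c assms(2,1)] by (simp add: algebra_simps)
  qed
  also have "\<dots> = (\<Sum>c\<in>I. \<epsilon> c) * ?G + \<epsilon> d * (int (card L) * g (l d x) - ?G)"
    using finite_classes assms(2) by (simp add: sum.distrib sum_distrib_right)
  finally show ?thesis
    using sum0 by simp
qed

lemma signed_collinearity_row_sum:
  assumes "x \<in> P" and "(\<Sum>c\<in>I. \<epsilon> c) = 0"
  shows "(\<Sum>z\<in>P. signed_collinearity \<epsilon> x z) = 0"
proof -
  obtain d where "d \<in> I" using two_classes by blast
  then show ?thesis
    using signed_collinearity_apply[OF assms(1) _ assms(2), of d "\<lambda>_. 1"] by simp
qed

text \<open>Expanding the second factor into line indicators \<open>N\<close> gives
  \<open>S S\<close> as the sum over \<open>d\<close> of \<open>card L N - J\<close>, since squared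
  signs are 1. The matrices \<open>N\<close> add up to \<open>card L I + J\<close>, as distinct
  points share exactly one class, and \<open>card L + 1\<close> copies of \<open>J\<close> are
  subtracted.\<close>

lemma signed_collinearity_square:
  assumes x: "x \<in> P" and y: "y \<in> P" and sum0: "(\<Sum>c\<in>I. \<epsilon> c) = 0"
    and sign: "\<And>c. c \<in> I \<Longrightarrow> \<epsilon> c \<in> {1, -1}"
  shows "(\<Sum>z\<in>P. signed_collinearity \<epsilon> x z * signed_collinearity \<epsilon> z y)
    = (if x = y then (int (card L))\<^sup>2 else 0) - 1"
proof -
  let ?N = "\<lambda>c x y. of_bool (l c x = l c y) :: int"
  have "(\<Sum>z\<in>P. signed_collinearity \<epsilon> x z * signed_collinearity \<epsilon> z y)
      = (\<Sum>z\<in>P. \<Sum>d\<in>I. \<epsilon> d * (signed_collinearity \<epsilon> x z * ?N d z y))"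
    by (simp add: signed_collinearity_def[of \<epsilon> _ y] sum_distrib_left mult_ac)
  also have "\<dots> = (\<Sum>d\<in>I. \<epsilon> d * (\<Sum>z\<in>P. signed_collinearity \<epsilon> x z * ?N d z y))"
    unfolding sum_distrib_left by (rule sum.swap)
  also have "\<dots> = (\<Sum>d\<in>I. int (card L) * ?N d x y - 1)"
  proof (rule sum.cong[OF refl])
    fix d assume d: "d \<in> I"
    \<comment> \<open>Here \<open>g\<close> is the indicator of the label of the line of class
      \<open>d\<close> through \<open>y\<close>.\<close>
    have "(\<Sum>t\<in>L. of_bool (t = l d y) :: int) = 1"
      using label_in[OF d y] finite_lines by (simp add: of_bool_def)
    then have "(\<Sum>z\<in>P. signed_collinearity \<epsilon> x z * ?N d z y) = \<epsilon> d * (int (card L) * ?N d x y - 1)"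
      using signed_collinearity_apply[OF x d sum0, of "\<lambda>t. of_bool (t = l d y)"] by simp
    then show "\<epsilon> d * (\<Sum>z\<in>P. signed_collinearity \<epsilon> x z * ?N d z y) = int (card L) * ?N d x y - 1"
      using sign[OF d] by auto
  qed
  also have "\<dots> = int (card L) * (\<Sum>d\<in>I. ?N d x y) - (int (card L) + 1)"
    by (simp add: sum_subtractf sum_distrib_left card_classes)
  also have "(\<Sum>d\<in>I. ?N d x y) = (if x = y then int (card L) + 1 else 1)"
  proof (cases "x = y")
    case False
    then obtain c where c: "c \<in> I" "\<And>d. d \<in> I \<Longrightarrow> l d x = l d y \<longleftrightarrow> d = c"
      using obtain_common_class[OF x y] by blast
    have "(\<Sum>d\<in>I. ?N d x y) = (\<Sum>d\<in>I. if d = c then 1 else 0)"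
      by (rule sum.cong) (auto simp: c(2))
    then show ?thesis
      using False c(1) finite_classes by simp
  qed (simp add: card_classes)
  finally show ?thesis
    by (auto simp: power2_eq_square algebra_simps)
qed

section \<open>The bordered conference matrix and its eigenvector\<close>

text \<open>The index \<open>None\<close> carries the border of ones. Zero row sums of
  \<open>S\<close> make the border orthogonal to the other rows, and its products add the
  \<open>J\<close> that \<open>S S\<close> lacks. For the eigenvector, the border entry cancels the
  \<open>-1\<close> in \<open>S_eigen\<close>, while the border row itself yields
  \<open>sum_f\<close>.\<close>

theorem regular_quaternary_hadamard:
  fixes \<epsilon> :: "'c \<Rightarrow> int" and f :: "'b \<Rightarrow> int"
  assumes sum0: "(\<Sum>c\<in>I. \<epsilon> c) = 0"
    and sign: "\<And>c. c \<in> I \<Longrightarrow> \<epsilon> c \<in> {1, -1}"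
    and d: "d \<in> I" "\<epsilon> d = 1"
    and f: "\<And>t. t \<in> L \<Longrightarrow> f t \<in> {1, -1}" "(\<Sum>t\<in>L. f t) = 1"
  shows "\<exists>H. quaternary_hadamard ((card L)\<^sup>2 + 1) H \<and> regular_with_row_sum H (of_nat (card L) + \<i>)"
proof -
  define S where "S = signed_collinearity \<epsilon>"
  define C where "C u v = (case u of
      None \<Rightarrow> (case v of None \<Rightarrow> 0 | Some _ \<Rightarrow> 1)
    | Some x \<Rightarrow> (case v of None \<Rightarrow> 1 | Some y \<Rightarrow> S x y))" for u v
  define D where "D u = (case u of None \<Rightarrow> 1 | Some x \<Rightarrow> f (l d x))" for u
  define V where "V = insert None (Some ` P)"
  have fin: "finite V"
    by (simp add: V_def finite_points)
  have card_V: "card V = (card L)\<^sup>2 + 1"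
    by (simp add: V_def finite_points card_image card_points)
  have sum_V: "(\<Sum>u\<in>V. F u) = F None + (\<Sum>x\<in>P. F (Some x))" for F :: "'a option \<Rightarrow> int"
    by (simp add: V_def finite_points sum.reindex)
  have sum_f: "(\<Sum>z\<in>P. f (l d z)) = int (card L)"
  proof -
    obtain c where c: "c \<in> I" "c \<noteq> d" by (rule obtain_other_class)
    have "(\<Sum>z\<in>P. f (l d z)) = (\<Sum>(s, t)\<in>L \<times> L. f t)"
      using sum.reindex_bij_betw[OF coordinates[OF c(1) d(1) c(2)], of "\<lambda>(s, t). f t"] by simp
    also have "\<dots> = (\<Sum>s\<in>L. \<Sum>t\<in>L. f t)"
      by (rule sum.cartesian_product[symmetric])
    finally show ?thesis
      using f(2) by simp
  qed
  have S_diag: "S x x = 0" for x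
    using sum0 by (simp add: S_def signed_collinearity_def)
  have S_off_diag: "S x y = 1 \<or> S x y = -1" if "x \<in> P" "y \<in> P" "x \<noteq> y" for x y
  proof -
    have "S x y \<in> \<epsilon> ` I"
      unfolding S_def using that by (rule signed_collinearity_off_diag)
    then obtain c where "c \<in> I" "S x y = \<epsilon> c"
      by (rule imageE)
    then show ?thesis
      using sign[of c] by simp
  qed
  have S_sym: "S x y = S y x" for x y
    unfolding S_def by (rule signed_collinearity_sym)
  have S_row: "(\<Sum>z\<in>P. S x z) = 0" if "x \<in> P" for x
    unfolding S_def using that sum0 by (rule signed_collinearity_row_sum)
  have S_col: "(\<Sum>z\<in>P. S z x) = 0" if "x \<in> P" for x
    using S_row[OF that] by (subst S_sym)
  have S_square: "(\<Sum>z\<in>P. S x z * S z y) = (if x = y then (int (card L))\<^sup>2 else 0) - 1"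
    if "x \<in> P" "y \<in> P" for x y
    unfolding S_def using that sum0 sign by (rule signed_collinearity_square)
  have S_eigen: "(\<Sum>z\<in>P. S x z * f (l d z)) = int (card L) * f (l d x) - 1" if "x \<in> P" for x
    using signed_collinearity_apply[OF that d(1) sum0, of f] d(2) f(2) by (simp add: S_def)
  have "\<exists>H. quaternary_hadamard (card V) H \<and>
      regular_with_row_sum H (of_int (int (card L)) + \<i>)"
  proof (rule quaternary_hadamard_of_conference[OF fin, where C = C and d = D])
    fix u assume u: "u \<in> V"
    show "C u u = 0"
      by (simp add: C_def S_diag split: option.split)
    show "D u \<in> {1, -1}"
    proof (cases u)
      case (Some x)
      then have "x \<in> P"
        using u by (auto simp: V_def)
      then show ?thesis
        using Some f(1)[OF label_in[OF d(1)]] by (simp add: D_def)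
    qed (simp add: D_def)
    show "(\<Sum>z\<in>V. C u z * D z) = int (card L) * D u"
      using u unfolding sum_V by (auto simp: C_def D_def V_def sum_f S_eigen)
    fix v assume v: "v \<in> V"
    show "C u v \<in> {1, -1}" if "u \<noteq> v"
      using u v that by (auto simp: V_def C_def dest: S_off_diag)
    show "C u v = C v u"
      by (simp add: C_def S_sym split: option.split)
    show "(\<Sum>z\<in>V. C u z * C z v) = (if u = v then int (card V) - 1 else 0)"
      using u v unfolding sum_V card_V
      by (auto simp: V_def C_def S_row S_col S_square card_points split: if_splits)
  qed
  then show ?thesis
    by (simp add: card_V)
qed

end

section \<open>The affine plane over the integers modulo \<open>p\<close>\<close>

lemma eq_if_dvd_mult_diff:
  fixes a b u v p :: nat
  assumes "prime p" and "u < p" "v < p" "a < p" "b < p" and "a \<noteq> b"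
    and "int p dvd (int a - int b) * (int u - int v)"
  shows "u = v"
proof -
  have small: "i = j" if "int p dvd int i - int j" "i < p" "j < p" for i j :: nat
  proof -
    have "int i mod int p = int j mod int p"
      using that(1) by (simp add: mod_eq_dvd_iff)
    then show ?thesis
      using that(2,3) by simp
  qed
  have "int p dvd int a - int b \<or> int p dvd int u - int v"
    using assms(1,7) by (simp add: prime_dvd_mult_iff)
  then show ?thesis
    using small assms by blast
qed

text \<open>Label of the line with slope \<open>-c\<close> through a point; \<open>c = p\<close> stands for the vertical lines.\<close>

definition line_label :: "nat \<Rightarrow> nat \<Rightarrow> nat \<times> nat \<Rightarrow> nat" where
  "line_label p c z = (if c = p then fst z else (snd z + c * fst z) mod p)"

lemma mod_eq_nat_dvd_iff: "(m :: nat) mod p = n mod p \<longleftrightarrow> int p dvd int m - int n"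
  unfolding mod_eq_dvd_iff[symmetric] of_nat_mod[symmetric] of_nat_eq_iff by (rule refl)

text \<open>Two lines of different slopes share at most one point: subtracting their congruences
  eliminates the second coordinate, and the nonzero slope difference can be cancelled modulo
  \<open>p\<close>.\<close>

lemma line_label_inj:
  assumes p: "prime p" and c: "c \<le> p" and d: "d \<le> p" and "c \<noteq> d"
    and x: "x \<in> {..<p} \<times> {..<p}" and y: "y \<in> {..<p} \<times> {..<p}"
    and "line_label p c x = line_label p c y" "line_label p d x = line_label p d y"
  shows "x = y"
proof -
  obtain a b a' b' where [simp]: "x = (a, b)" "y = (a', b')"
    by (cases x, cases y)
  have bounds: "a < p" "b < p" "a' < p" "b' < p"
    using x y by auto
  have dvd: "int p dvd int b + int e * int a - (int b' + int e * int a')"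
    if "e < p" "line_label p e x = line_label p e y" for e
    using that by (simp add: line_label_def mod_eq_nat_dvd_iff)
  have a: "a = a'"
  proof (cases "c = p \<or> d = p")
    case True
    then show ?thesis
      using assms(7,8) by (auto simp: line_label_def)
  next
    case False
    then have cd: "c < p" "d < p" using c d by auto
    have "int p dvd (int b + int c * int a - (int b' + int c * int a'))
        - (int b + int d * int a - (int b' + int d * int a'))"
      by (intro dvd_diff dvd cd assms(7,8))
    then have "int p dvd (int c - int d) * (int a - int a')"
      by (simp add: algebra_simps)
    then show ?thesis
      using eq_if_dvd_mult_diff p cd bounds \<open>c \<noteq> d\<close> by blast
  qed
  \<comment> \<open>At most one of the two classes is vertical; the other gives a congruence that
    determines the second coordinate.\<close>
  obtain e where e: "e < p" "line_label p e x = line_label p e y"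
    using assms(4,7,8) c d by (metis le_neq_implies_less)
  have "b mod p = b' mod p"
    using dvd[OF e] a by (simp add: mod_eq_nat_dvd_iff)
  then show ?thesis
    using a bounds by simp
qed

text \<open>Points with different first coordinates are joined by a slope found by counting instead
  of modular division: an injective self-map of the residues attains 0.\<close>

lemma line_label_joined:
  assumes p: "prime p" and x: "x \<in> {..<p} \<times> {..<p}" and y: "y \<in> {..<p} \<times> {..<p}"
  shows "\<exists>c\<le>p. line_label p c x = line_label p c y"
proof (cases "fst x = fst y")
  case True
  then show ?thesis
    by (intro exI[of _ p]) (simp add: line_label_def)
next
  case False
  obtain a b a' b' where [simp]: "x = (a, b)" "y = (a', b')"
    by (cases x, cases y)
  have bounds: "a < p" "b < p" "a' < p" "b' < p"
    using x y by auto
  have "0 < int p"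
    using prime_gt_0_nat[OF p] by simp
  \<comment> \<open>The residue \<open>k c\<close> measures how far apart the labels of
    \<open>x\<close> and \<open>y\<close> are in class \<open>c\<close>; it is 0 exactly when they
    agree.\<close>
  define k where "k c = nat ((int b + int c * int a - (int b' + int c * int a')) mod int p)" for c
  have inj: "inj_on k {..<p}"
  proof (rule inj_onI)
    fix c d assume cd: "c \<in> {..<p}" "d \<in> {..<p}" and eq: "k c = k d"
    have "(int b + int c * int a - (int b' + int c * int a')) mod int p
        = (int b + int d * int a - (int b' + int d * int a')) mod int p"
      using eq unfolding k_def eq_nat_nat_iff[OF pos_mod_sign pos_mod_sign, OF \<open>0 < int p\<close> \<open>0 < int p\<close>] .
    then have "int p dvd (int b + int c * int a - (int b' + int c * int a'))
        - (int b + int d * int a - (int b' + int d * int a'))"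
      by (simp only: mod_eq_dvd_iff)
    then have dvd: "int p dvd (int a - int a') * (int c - int d)"
      by (simp add: algebra_simps)
    show "c = d"
      by (rule eq_if_dvd_mult_diff[OF p _ _ bounds(1,3) _ dvd]) (use cd False in auto)
  qed
  have "k ` {..<p} \<subseteq> {..<p}"
    using \<open>0 < int p\<close> by (auto simp: k_def nat_less_iff)
  then have "k ` {..<p} = {..<p}"
    by (intro endo_inj_surj inj) auto
  moreover have "0 \<in> {..<p}"
    using \<open>0 < int p\<close> by simp
  ultimately have "0 \<in> k ` {..<p}"
    by simp
  then obtain c where c: "c < p" "k c = 0"
    by auto
  have "(int b + int c * int a - (int b' + int c * int a')) mod int p = 0"
    using c(2) pos_mod_sign[OF \<open>0 < int p\<close>] by (simp add: k_def order_antisym)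
  then have "line_label p c x = line_label p c y"
    using c(1) by (simp add: line_label_def mod_eq_nat_dvd_iff dvd_eq_mod_eq_0)
  then show ?thesis
    using c(1) by (intro exI[of _ c]) simp
qed

lemma affine_plane_line_label:
  assumes p: "prime p"
  shows "affine_plane {..p} ({..<p} \<times> {..<p}) {..<p} (line_label p)"
proof
  have "p > 0"
    using p by (rule prime_gt_0_nat)
  then show "{..<p} \<noteq> {}"
    by auto
  fix c d assume cd: "c \<in> {..p}" "d \<in> {..p}" "c \<noteq> d"
  let ?g = "\<lambda>z. (line_label p c z, line_label p d z)"
  have inj: "inj_on ?g ({..<p} \<times> {..<p})"
    by (intro inj_onI line_label_inj[OF p _ _ cd(3)]) (use cd in auto)
  have "?g ` ({..<p} \<times> {..<p}) \<subseteq> {..<p} \<times> {..<p}"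
    using \<open>p > 0\<close> by (auto simp: line_label_def)
  \<comment> \<open>Both sides of the coordinate map are the same finite grid, so injectivity
    already gives surjectivity.\<close>
  then have "?g ` ({..<p} \<times> {..<p}) = {..<p} \<times> {..<p}"
    by (intro endo_inj_surj inj) auto
  with inj show "bij_betw ?g ({..<p} \<times> {..<p}) ({..<p} \<times> {..<p})"
    by (simp add: bij_betw_def)
next
  show "\<exists>c\<in>{..p}. line_label p c x = line_label p c y"
    if "x \<in> {..<p} \<times> {..<p}" "y \<in> {..<p} \<times> {..<p}" for x y
    using line_label_joined[OF p that] by auto
qed auto

section \<open>The choice of signs\<close>

lemma sum_half_signs:
  fixes m :: nat
  shows "(\<Sum>t<2 * m + 1. if t \<le> m then 1 else -1 :: int) = 1"
proof -
  let ?f = "\<lambda>t. if t \<le> m then 1 else -1 :: int"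
  have "sum ?f {..<2 * m + 1} = sum ?f ({..m} \<union> {m<..<2 * m + 1})"
    by (rule sum.cong) auto
  also have "\<dots> = sum ?f {..m} + sum ?f {m<..<2 * m + 1}"
    by (rule sum.union_disjoint) auto
  finally show ?thesis
    by simp
qed

theorem theorem3p3:
  fixes p :: nat
  assumes "prime p" and "odd p"
  shows "\<exists>H. quaternary_hadamard (p\<^sup>2 + 1) H \<and> regular_with_row_sum H (of_nat p + \<i>)"
proof -
  interpret affine_plane "{..p}" "{..<p} \<times> {..<p}" "{..<p}" "line_label p"
    using assms(1) by (rule affine_plane_line_label)
  obtain m where m: "p = 2 * m + 1"
    using assms(2) by (elim oddE)
  define f where "f t = (if t \<le> m then 1 else -1 :: int)" for t
  \<comment> \<open>The vertical class \<open>p\<close> gets sign 1 and carries the eigenvector; the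
    signs \<open>- f c\<close> of the other \<open>p\<close> classes sum to -1, so the total is
    0.\<close>
  define \<epsilon> where "\<epsilon> c = (if c = p then 1 else - f c)" for c
  have f: "(\<Sum>t<p. f t) = 1"
    unfolding m f_def by (rule sum_half_signs)
  have "(\<Sum>c\<le>p. \<epsilon> c) = \<epsilon> p + (\<Sum>c<p. - f c)"
    unfolding lessThan_Suc_atMost[symmetric] sum.lessThan_Suc
    by (simp add: \<epsilon>_def)
  then have "(\<Sum>c\<le>p. \<epsilon> c) = 0"
    using f by (simp add: \<epsilon>_def sum_negf)
  then show ?thesis
    using regular_quaternary_hadamard[of \<epsilon> p f] f by (auto simp: \<epsilon>_def f_def)
qed

end
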